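(* The solution to the stochastic problem $\mathbf{P}$ (described in the context) remains deterministic, with the optimal sequence of store levels as given in the case where the stochastic cost functions $C_t=\xi_t\bar C_t$ are replaced by their deterministic counterparts $\bar C_t$: that is, any solution $\bar S$ of the deterministic problem $\bar{\mathbf{P}}$, regarded as a constant random vector, is a solution of the stochastic problem $\mathbf{P}$. Further, the optimised value of the objective function $\mathbf{E}\bigl[\sum_{t=1}^T C_t(x_t(S))\bigr]$ of the stochastic problem $\mathbf{P}$ is the same as the optimised value of the objective function $\sum_{t=1}^T\bar C_t(x_t(S))$ of the deterministic problem $\bar{\mathbf{P}}$.
   Context: Data: an integer $T\ge1$; a capacity $E>0$; rate constraints $P_i>0$ and $P_o>0$; a leakage parameter $\rho$ with $0<\rho\le1$; $X=\{x\in\mathbb{R}:-P_o\le x\le P_i\}$; deterministic convex cost functions $\bar C_t:\mathbb{R}\to\mathbb{R}$, $1\le t\le T$; fixed real constants $S^*_0$, $S^*_T$. For $S=(S_0,\dots,S_T)$ put $x_t(S)=S_t-\rho S_{t-1}$, $1\le t\le T$. Deterministic problem $\bar{\mathbf{P}}$: minimise $\sum_{t=1}^T\bar C_t(x_t(S))$ over deterministic $S\in\mathbb{R}^{T+1}$ with $S_0=S^*_0$, $S_T=S^*_T$, $0\le S_t\le E$ for $1\le t\le T-1$, and $x_t(S)\in X$ for $1\le t\le T$. The set of vectors satisfying these constraints is assumed nonempty. Stochastic costs: $(\xi_1,\dots,\xi_T)$ is a sequence of strictly positive (integrable) real-valued random variables on a probability space; $\mathcal{F}_t$ is the $\sigma$-algebra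 generated by $\xi_1,\dots,\xi_t$, with $\mathcal{F}_0$ the trivial $\sigma$-algebra; $\xi_0=1$; and the martingale property $\mathbf{E}(\xi_t\mid\mathcal{F}_{t-1})=\xi_{t-1}$ holds for $1\le t\le T$, where $\mathbf{E}$ denotes expectation. The random cost functions are $C_t=\xi_t\bar C_t$, $1\le t\le T$. Stochastic problem $\mathbf{P}$: choose a random vector $S=(S_1,\dots,S_T)$ with $S_t$ measurable with respect to $\mathcal{F}_t$ for each $t$, so as to minimise $\mathbf{E}\bigl[\sum_{t=1}^T C_t(x_t(S))\bigr]$, with $S_0=S^*_0$ and $S_T=S^*_T$, subject to $0\le S_t\le E$ for $1\le t\le T-1$ and $x_t(S)\in X$ for $1\le t\le T$. *)

theory Defs
  imports "HOL-Probability.Probability"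
begin

text \<open>
  Store levels are sequences \<open>S :: nat \<Rightarrow> real\<close> of which only \<open>S 0, \<dots>, S T\<close> matter:
  constraints and objectives never refer to indices above \<open>T\<close>.
\<close>

definition level_change :: "real \<Rightarrow> (nat \<Rightarrow> real) \<Rightarrow> nat \<Rightarrow> real" where
  "level_change \<rho> S t = S t - \<rho> * S (t - 1)"

definition rate_set :: "real \<Rightarrow> real \<Rightarrow> real set" where
  "rate_set P\<^sub>i P\<^sub>o = {- P\<^sub>o..P\<^sub>i}"

text \<open>The levels \<open>S\<^sub>0\<close> and \<open>S\<^sub>T\<close> are prescribed and need not lie in \<open>[0, E]\<close>.\<close>

definition det_feasible ::
  "nat \<Rightarrow> real \<Rightarrow> real \<Rightarrow> real \<Rightarrow> real \<Rightarrow> real \<Rightarrow> real \<Rightarrow> (nat \<Rightarrow> real) set" where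
  "det_feasible T E P\<^sub>i P\<^sub>o \<rho> S\<^sub>0 S\<^sub>T = {S.
     S 0 = S\<^sub>0 \<and> S T = S\<^sub>T \<and>
     (\<forall>t\<in>{1..<T}. 0 \<le> S t \<and> S t \<le> E) \<and>
     (\<forall>t\<in>{1..T}. level_change \<rho> S t \<in> rate_set P\<^sub>i P\<^sub>o)}"

definition det_objective ::
  "nat \<Rightarrow> real \<Rightarrow> (nat \<Rightarrow> real \<Rightarrow> real) \<Rightarrow> (nat \<Rightarrow> real) \<Rightarrow> real" where
  "det_objective T \<rho> C S = (\<Sum>t = 1..T. C t (level_change \<rho> S t))"

text \<open>
  The \<open>\<sigma>\<close>-algebra generated by \<open>\<xi>\<^sub>1, \<dots>, \<xi>\<^sub>t\<close>; for \<open>t = 0\<close> the generator is empty and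
  the \<open>\<sigma>\<close>-algebra is trivial.
\<close>

definition generated_by :: "'a measure \<Rightarrow> (nat \<Rightarrow> 'a \<Rightarrow> real) \<Rightarrow> nat \<Rightarrow> 'a measure" where
  "generated_by M \<xi> t =
     sigma (space M) (\<Union>i\<in>{1..t}. {\<xi> i -` A \<inter> space M | A. A \<in> sets borel})"

text \<open>
  The constraints on a random vector hold almost surely. Adaptedness at \<open>t = 0\<close> makes
  \<open>S 0\<close> constant, so \<open>S 0\<close> is everywhere equal to the prescribed initial level.
\<close>

definition stoch_feasible ::
  "'a measure \<Rightarrow> (nat \<Rightarrow> 'a \<Rightarrow> real) \<Rightarrow> nat \<Rightarrow> real \<Rightarrow> real \<Rightarrow> real \<Rightarrow> real \<Rightarrow> real \<Rightarrow> real
    \<Rightarrow> (nat \<Rightarrow> 'a \<Rightarrow> real) set" where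
  "stoch_feasible M \<xi> T E P\<^sub>i P\<^sub>o \<rho> S\<^sub>0 S\<^sub>T = {S.
     (\<forall>t\<in>{0..T}. S t \<in> borel_measurable (generated_by M \<xi> t)) \<and>
     (AE \<omega> in M. (\<lambda>t. S t \<omega>) \<in> det_feasible T E P\<^sub>i P\<^sub>o \<rho> S\<^sub>0 S\<^sub>T)}"

definition random_cost ::
  "(nat \<Rightarrow> 'a \<Rightarrow> real) \<Rightarrow> (nat \<Rightarrow> real \<Rightarrow> real) \<Rightarrow> 'a \<Rightarrow> nat \<Rightarrow> real \<Rightarrow> real" where
  "random_cost \<xi> C \<omega> t x = \<xi> t \<omega> * C t x"

text \<open>
  For integrable \<open>\<xi>\<^sub>t\<close> and convex \<open>C\<^sub>t\<close> the integrand is integrable at every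
  feasible \<open>S\<close>, because the convex function \<open>C\<^sub>t\<close> is continuous, hence bounded on the
  compact rate set; so the Bochner integral never takes its default value there.
\<close>

definition stoch_objective ::
  "'a measure \<Rightarrow> (nat \<Rightarrow> 'a \<Rightarrow> real) \<Rightarrow> nat \<Rightarrow> real \<Rightarrow> (nat \<Rightarrow> real \<Rightarrow> real)
    \<Rightarrow> (nat \<Rightarrow> 'a \<Rightarrow> real) \<Rightarrow> real" where
  "stoch_objective M \<xi> T \<rho> C S =
     (LINT \<omega>|M. (\<Sum>t = 1..T. random_cost \<xi> C \<omega> t (level_change \<rho> (\<lambda>s. S s \<omega>) t)))"

end

theory Submission
  imports Defs
begin

text \<open>
  The martingale property turns \<open>\<xi>\<^sub>T\<close> into a density. For \<open>X\<close> bounded and known at time \<open>t\<close>,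
  \<open>E(\<xi>\<^sub>t X) = E(\<xi>\<^sub>T X)\<close> (\<open>martingale_expectation_mult\<close>), so
  in the expected cost of an admissible strategy every price \<open>\<xi>\<^sub>t\<close> may be replaced by the single
  terminal price \<open>\<xi>\<^sub>T\<close> (\<open>stoch_objective_eq_terminal\<close>). The expected cost is thus a
  \<open>\<xi>\<^sub>T\<close>-weighted average of the deterministic costs of the realised paths, with total weight
  \<open>E(\<xi>\<^sub>T) = \<xi>\<^sub>0 = 1\<close>. Almost every realised path is feasible for the deterministic problem, so no
  such average lies below a lower bound of the deterministic costs
  (\<open>stoch_objective_ge\<close>); a deterministic strategy attains exactly its deterministic cost
  (\<open>stoch_objective_const\<close>).

  Convexity makes the cost functions continuous, so the random costs are measurable, and bounded
  on the compact rate set; this is what makes the expectations finite.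
\<close>

lemma sets_generated_by:
  "sets (generated_by M \<xi> t) =
     sigma_sets (space M) (\<Union>i\<in>{1..t}. {\<xi> i -` A \<inter> space M | A. A \<in> sets borel})"
  unfolding generated_by_def by (rule sets_measure_of) auto

lemma space_generated_by [simp]: "space (generated_by M \<xi> t) = space M"
  unfolding generated_by_def by (rule space_measure_of) auto

lemma subalgebra_generated_by:
  assumes "\<And>i. i \<in> {1..t} \<Longrightarrow> \<xi> i \<in> borel_measurable M"
  shows "subalgebra M (generated_by M \<xi> t)"
proof -
  have "(\<Union>i\<in>{1..t}. {\<xi> i -` A \<inter> space M | A. A \<in> sets borel}) \<subseteq> sets M"
    using assms by (auto intro: measurable_sets)
  then show ?thesis
    unfolding subalgebra_def sets_generated_by by (simp add: sets.sigma_sets_subset)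
qed

lemma subalgebra_generated_by_mono:
  assumes "s \<le> t"
  shows "subalgebra (generated_by M \<xi> t) (generated_by M \<xi> s)"
proof -
  have "{1..s} \<subseteq> {1..t}"
    using assms by auto
  then show ?thesis
    unfolding subalgebra_def sets_generated_by
    by (intro conjI sigma_sets_mono' UN_mono) simp_all
qed

lemma integrable_mult_AE_bounded:
  fixes X Y :: "'a \<Rightarrow> real"
  assumes "integrable M Y" and [measurable]: "X \<in> borel_measurable M"
    and bound: "AE \<omega> in M. \<bar>X \<omega>\<bar> \<le> K"
  shows "integrable M (\<lambda>\<omega>. Y \<omega> * X \<omega>)"
proof (rule Bochner_Integration.integrable_bound)
  show "integrable M (\<lambda>\<omega>. K * Y \<omega>)"
    using assms(1) by simp
  show "(\<lambda>\<omega>. Y \<omega> * X \<omega>) \<in> borel_measurable M"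
    using assms(1) by measurable
  show "AE \<omega> in M. norm (Y \<omega> * X \<omega>) \<le> norm (K * Y \<omega>)"
    using bound
  proof eventually_elim
    case (elim \<omega>)
    then have "\<bar>X \<omega>\<bar> * \<bar>Y \<omega>\<bar> \<le> \<bar>K\<bar> * \<bar>Y \<omega>\<bar>"
      by (intro mult_right_mono) auto
    then show ?case by (simp add: abs_mult mult.commute)
  qed
qed

text \<open>
  Conditioning on \<open>\<F>\<^sub>s\<close> replaces \<open>\<xi>\<^sub>s\<^sub>+\<^sub>1\<close> by \<open>\<xi>\<^sub>s\<close> against a factor that is already known at
  time \<open>s\<close>; iterating this from \<open>t\<close> to \<open>n\<close> gives the claim.
\<close>

lemma martingale_expectation_mult:
  fixes \<xi> :: "nat \<Rightarrow> 'a \<Rightarrow> real"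
  assumes "prob_space M"
    and int: "\<And>t. t \<le> T \<Longrightarrow> integrable M (\<xi> t)"
    and mart: "\<And>t. t \<in> {1..T} \<Longrightarrow>
          AE \<omega> in M. real_cond_exp M (generated_by M \<xi> (t - 1)) (\<xi> t) \<omega> = \<xi> (t - 1) \<omega>"
    and X: "X \<in> borel_measurable (generated_by M \<xi> t)"
    and bound: "AE \<omega> in M. \<bar>X \<omega>\<bar> \<le> K"
    and "t \<le> n" and "n \<le> T"
  shows "(LINT \<omega>|M. \<xi> n \<omega> * X \<omega>) = (LINT \<omega>|M. \<xi> t \<omega> * X \<omega>)"
  using \<open>t \<le> n\<close> \<open>n \<le> T\<close>
proof (induction n rule: dec_induct)
  case base
  show ?case ..
next
  case (step n)
  interpret prob_space M by fact
  let ?F = "generated_by M \<xi> n"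
  have sub: "subalgebra M ?F"
    using int step.prems by (intro subalgebra_generated_by borel_measurable_integrable) auto
  interpret finite_measure_subalgebra M ?F
    by unfold_locales (rule sub)
  have XF: "X \<in> borel_measurable ?F"
    using measurable_from_subalg[OF subalgebra_generated_by_mono[OF step.hyps(1)] X] .
  have [measurable]: "X \<in> borel_measurable M"
    using measurable_from_subalg[OF sub XF] .
  have [measurable]: "\<xi> n \<in> borel_measurable M" "\<xi> (Suc n) \<in> borel_measurable M"
    using int step.prems by (auto intro!: borel_measurable_integrable)
  have "integrable M (\<lambda>\<omega>. X \<omega> * \<xi> (Suc n) \<omega>)"
    using integrable_mult_AE_bounded[OF int[OF step.prems] _ bound] by (simp add: mult.commute)
  then have "(LINT \<omega>|M. X \<omega> * \<xi> (Suc n) \<omega>) =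
      (LINT \<omega>|M. X \<omega> * real_cond_exp M ?F (\<xi> (Suc n)) \<omega>)"
    using XF by (simp add: real_cond_exp_intg(2))
  also have "\<dots> = (LINT \<omega>|M. X \<omega> * \<xi> n \<omega>)"
    using mart[of "Suc n"] step.prems by (intro integral_cong_AE) auto
  finally show ?case
    using step by (simp add: mult.commute)
qed

lemma convex_imp_borel_measurable:
  fixes f :: "real \<Rightarrow> real"
  assumes "convex_on UNIV f"
  shows "f \<in> borel_measurable borel"
  using assms by (intro borel_measurable_continuous_onI convex_on_continuous) auto

lemma convex_bounded_on_rate_set:
  fixes f :: "real \<Rightarrow> real"
  assumes "convex_on UNIV f"
  obtains K where "\<And>x. x \<in> rate_set P\<^sub>i P\<^sub>o \<Longrightarrow> \<bar>f x\<bar> \<le> K"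
proof -
  have "continuous_on (rate_set P\<^sub>i P\<^sub>o) f"
    using convex_on_continuous[OF open_UNIV assms] continuous_on_subset by blast
  then have "bounded (f ` rate_set P\<^sub>i P\<^sub>o)"
    by (intro compact_imp_bounded compact_continuous_image) (auto simp: rate_set_def)
  then show ?thesis
    using that by (auto simp: bounded_iff)
qed

text \<open>
  Since \<open>C\<^sub>t(x\<^sub>t(S))\<close> is known at time \<open>t\<close> and is almost surely bounded, its price \<open>\<xi>\<^sub>t\<close> may
  be exchanged for the later price \<open>\<xi>\<^sub>T\<close>, which is common to all periods.
\<close>

lemma stoch_objective_eq_terminal:
  fixes \<xi> :: "nat \<Rightarrow> 'a \<Rightarrow> real"
  assumes "prob_space M"
    and int: "\<And>t. t \<le> T \<Longrightarrow> integrable M (\<xi> t)"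
    and mart: "\<And>t. t \<in> {1..T} \<Longrightarrow>
          AE \<omega> in M. real_cond_exp M (generated_by M \<xi> (t - 1)) (\<xi> t) \<omega> = \<xi> (t - 1) \<omega>"
    and conv: "\<And>t. t \<in> {1..T} \<Longrightarrow> convex_on UNIV (C t)"
    and S: "S \<in> stoch_feasible M \<xi> T E P\<^sub>i P\<^sub>o \<rho> S\<^sub>0 S\<^sub>T"
  shows "integrable M (\<lambda>\<omega>. \<xi> T \<omega> * det_objective T \<rho> C (\<lambda>t. S t \<omega>))"
    and "stoch_objective M \<xi> T \<rho> C S =
      (LINT \<omega>|M. \<xi> T \<omega> * det_objective T \<rho> C (\<lambda>t. S t \<omega>))"
proof -
  define X where "X t \<omega> = C t (level_change \<rho> (\<lambda>s. S s \<omega>) t)" for t \<omega>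
  have adapted: "X t \<in> borel_measurable (generated_by M \<xi> t)" if t: "t \<in> {1..T}" for t
  proof -
    note [measurable] = convex_imp_borel_measurable[OF conv[OF t]]
    have [measurable]: "S t \<in> borel_measurable (generated_by M \<xi> t)"
      using S t by (auto simp: stoch_feasible_def)
    have "S (t - 1) \<in> borel_measurable (generated_by M \<xi> (t - 1))"
      using S t by (auto simp: stoch_feasible_def)
    then have [measurable]: "S (t - 1) \<in> borel_measurable (generated_by M \<xi> t)"
      by (rule measurable_from_subalg[OF subalgebra_generated_by_mono, rotated]) simp
    show ?thesis
      unfolding X_def level_change_def by measurable
  qed
  have bounded: "\<exists>K. AE \<omega> in M. \<bar>X t \<omega>\<bar> \<le> K" if t: "t \<in> {1..T}" for t
  proof -
    obtain K where K: "\<And>x. x \<in> rate_set P\<^sub>i P\<^sub>o \<Longrightarrow> \<bar>C t x\<bar> \<le> K"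
      using convex_bounded_on_rate_set[OF conv[OF t]] by blast
    have "AE \<omega> in M. (\<lambda>t. S t \<omega>) \<in> det_feasible T E P\<^sub>i P\<^sub>o \<rho> S\<^sub>0 S\<^sub>T"
      using S by (simp add: stoch_feasible_def)
    then have "AE \<omega> in M. \<bar>X t \<omega>\<bar> \<le> K"
      by eventually_elim (use K t in \<open>auto simp: det_feasible_def X_def\<close>)
    then show ?thesis ..
  qed
  have integrable_cost: "integrable M (\<lambda>\<omega>. \<xi> n \<omega> * X t \<omega>)"
    if t: "t \<in> {1..T}" and n: "n \<le> T" for t n
  proof -
    have "subalgebra M (generated_by M \<xi> t)"
      using int t by (intro subalgebra_generated_by borel_measurable_integrable) auto
    then have "X t \<in> borel_measurable M"
      by (rule measurable_from_subalg[OF _ adapted[OF t]])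
    moreover obtain K where "AE \<omega> in M. \<bar>X t \<omega>\<bar> \<le> K"
      using bounded[OF t] by blast
    ultimately show ?thesis
      by (rule integrable_mult_AE_bounded[OF int[OF n]])
  qed
  have path_cost: "\<xi> T \<omega> * det_objective T \<rho> C (\<lambda>t. S t \<omega>) = (\<Sum>t = 1..T. \<xi> T \<omega> * X t \<omega>)" for \<omega>
    by (simp add: det_objective_def X_def sum_distrib_left)
  show "integrable M (\<lambda>\<omega>. \<xi> T \<omega> * det_objective T \<rho> C (\<lambda>t. S t \<omega>))"
    unfolding path_cost using integrable_cost by auto
  have "stoch_objective M \<xi> T \<rho> C S = (\<Sum>t = 1..T. LINT \<omega>|M. \<xi> t \<omega> * X t \<omega>)"
    unfolding stoch_objective_def random_cost_def X_def[symmetric]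
    using integrable_cost by (intro Bochner_Integration.integral_sum) auto
  also have "\<dots> = (\<Sum>t = 1..T. LINT \<omega>|M. \<xi> T \<omega> * X t \<omega>)"
  proof (rule sum.cong[OF refl])
    fix t assume t: "t \<in> {1..T}"
    then obtain K where K: "AE \<omega> in M. \<bar>X t \<omega>\<bar> \<le> K"
      using bounded by blast
    show "(LINT \<omega>|M. \<xi> t \<omega> * X t \<omega>) = (LINT \<omega>|M. \<xi> T \<omega> * X t \<omega>)"
      using t by (intro martingale_expectation_mult[OF \<open>prob_space M\<close> int mart
            adapted[OF t] K, symmetric]) auto
  qed
  also have "\<dots> = (LINT \<omega>|M. \<xi> T \<omega> * det_objective T \<rho> C (\<lambda>t. S t \<omega>))"
    unfolding path_cost using integrable_cost
    by (intro Bochner_Integration.integral_sum[symmetric]) auto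
  finally show "stoch_objective M \<xi> T \<rho> C S =
      (LINT \<omega>|M. \<xi> T \<omega> * det_objective T \<rho> C (\<lambda>t. S t \<omega>))" .
qed

lemma stoch_objective_ge:
  fixes \<xi> :: "nat \<Rightarrow> 'a \<Rightarrow> real"
  assumes "prob_space M"
    and int: "\<And>t. t \<le> T \<Longrightarrow> integrable M (\<xi> t)"
    and mart: "\<And>t. t \<in> {1..T} \<Longrightarrow>
          AE \<omega> in M. real_cond_exp M (generated_by M \<xi> (t - 1)) (\<xi> t) \<omega> = \<xi> (t - 1) \<omega>"
    and conv: "\<And>t. t \<in> {1..T} \<Longrightarrow> convex_on UNIV (C t)"
    and nonneg: "AE \<omega> in M. \<xi> T \<omega> \<ge> 0"
    and weight: "(LINT \<omega>|M. \<xi> T \<omega>) = 1"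
    and S: "S \<in> stoch_feasible M \<xi> T E P\<^sub>i P\<^sub>o \<rho> S\<^sub>0 S\<^sub>T"
    and lower: "\<And>s. s \<in> det_feasible T E P\<^sub>i P\<^sub>o \<rho> S\<^sub>0 S\<^sub>T \<Longrightarrow> m \<le> det_objective T \<rho> C s"
  shows "m \<le> stoch_objective M \<xi> T \<rho> C S"
proof -
  note terminal = stoch_objective_eq_terminal[OF \<open>prob_space M\<close> int mart conv S]
  have "AE \<omega> in M. (\<lambda>t. S t \<omega>) \<in> det_feasible T E P\<^sub>i P\<^sub>o \<rho> S\<^sub>0 S\<^sub>T"
    using S by (simp add: stoch_feasible_def)
  with nonneg have "AE \<omega> in M. \<xi> T \<omega> * m \<le> \<xi> T \<omega> * det_objective T \<rho> C (\<lambda>t. S t \<omega>)"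
    by eventually_elim (auto intro: mult_left_mono lower)
  then have "(LINT \<omega>|M. \<xi> T \<omega> * m) \<le> (LINT \<omega>|M. \<xi> T \<omega> * det_objective T \<rho> C (\<lambda>t. S t \<omega>))"
    using int[of T] terminal(1) by (intro integral_mono_AE) auto
  also have "\<dots> = stoch_objective M \<xi> T \<rho> C S"
    using terminal(2) by simp
  finally show ?thesis
    using weight by simp
qed

lemma const_stoch_feasible:
  assumes "s \<in> det_feasible T E P\<^sub>i P\<^sub>o \<rho> S\<^sub>0 S\<^sub>T"
  shows "(\<lambda>t \<omega>. s t) \<in> stoch_feasible M \<xi> T E P\<^sub>i P\<^sub>o \<rho> S\<^sub>0 S\<^sub>T"
  using assms by (simp add: stoch_feasible_def)

lemma stoch_objective_const:
  assumes "\<And>t. t \<in> {1..T} \<Longrightarrow> integrable M (\<xi> t)"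
    and "\<And>t. t \<in> {1..T} \<Longrightarrow> (LINT \<omega>|M. \<xi> t \<omega>) = 1"
  shows "stoch_objective M \<xi> T \<rho> C (\<lambda>t \<omega>. s t) = det_objective T \<rho> C s"
  using assms by (simp add: stoch_objective_def random_cost_def det_objective_def)

theorem theorem6:
  fixes M :: "'a measure" and \<xi> :: "nat \<Rightarrow> 'a \<Rightarrow> real"
    and C :: "nat \<Rightarrow> real \<Rightarrow> real" and T :: nat
    and E P\<^sub>i P\<^sub>o \<rho> S\<^sub>0 S\<^sub>T :: real
  assumes "T \<ge> 1" and "E > 0" and "P\<^sub>i > 0" and "P\<^sub>o > 0" and "0 < \<rho>" and "\<rho> \<le> 1"
    and "\<And>t. t \<in> {1..T} \<Longrightarrow> convex_on UNIV (C t)"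
    and "det_feasible T E P\<^sub>i P\<^sub>o \<rho> S\<^sub>0 S\<^sub>T \<noteq> {}"
    and "prob_space M"
    and "\<And>t. t \<in> {1..T} \<Longrightarrow> integrable M (\<xi> t)"
    and "\<And>t. t \<in> {1..T} \<Longrightarrow> AE \<omega> in M. \<xi> t \<omega> > 0"
    and "\<And>\<omega>. \<omega> \<in> space M \<Longrightarrow> \<xi> 0 \<omega> = 1"
    and "\<And>t. t \<in> {1..T} \<Longrightarrow>
          AE \<omega> in M. real_cond_exp M (generated_by M \<xi> (t - 1)) (\<xi> t) \<omega> = \<xi> (t - 1) \<omega>"
  shows "(\<forall>S. is_arg_min (det_objective T \<rho> C)
                  (\<lambda>S. S \<in> det_feasible T E P\<^sub>i P\<^sub>o \<rho> S\<^sub>0 S\<^sub>T) S \<longrightarrow>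
               is_arg_min (stoch_objective M \<xi> T \<rho> C)
                  (\<lambda>S. S \<in> stoch_feasible M \<xi> T E P\<^sub>i P\<^sub>o \<rho> S\<^sub>0 S\<^sub>T) (\<lambda>t \<omega>. S t)) \<and>
         (INF S\<in>stoch_feasible M \<xi> T E P\<^sub>i P\<^sub>o \<rho> S\<^sub>0 S\<^sub>T. ereal (stoch_objective M \<xi> T \<rho> C S)) =
         (INF S\<in>det_feasible T E P\<^sub>i P\<^sub>o \<rho> S\<^sub>0 S\<^sub>T. ereal (det_objective T \<rho> C S))"
proof -
  interpret prob_space M by fact
  let ?D = "det_feasible T E P\<^sub>i P\<^sub>o \<rho> S\<^sub>0 S\<^sub>T"
  let ?S = "stoch_feasible M \<xi> T E P\<^sub>i P\<^sub>o \<rho> S\<^sub>0 S\<^sub>T"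
  have "integrable M (\<xi> 0) \<longleftrightarrow> integrable M (\<lambda>_. 1 :: real)"
    by (rule Bochner_Integration.integrable_cong) (auto simp: assms(12))
  then have int: "integrable M (\<xi> t)" if "t \<le> T" for t
    using assms(10)[of t] that by (cases "t = 0") auto
  have "(LINT \<omega>|M. \<xi> 0 \<omega>) = (LINT \<omega>|M. 1)"
    by (rule Bochner_Integration.integral_cong) (auto simp: assms(12))
  then have expectation: "(LINT \<omega>|M. \<xi> t \<omega>) = 1" if "t \<le> T" for t
    using martingale_expectation_mult[OF \<open>prob_space M\<close> int assms(13),
        where X = "\<lambda>_. 1" and K = 1 and t = 0 and n = t] that
    by (simp add: prob_space)
  have const: "stoch_objective M \<xi> T \<rho> C (\<lambda>t \<omega>. s t) = det_objective T \<rho> C s" for s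
    using int expectation by (intro stoch_objective_const) auto
  have nonneg: "AE \<omega> in M. \<xi> T \<omega> \<ge> 0"
    using assms(11)[of T] \<open>T \<ge> 1\<close> by auto
  have lower: "m \<le> stoch_objective M \<xi> T \<rho> C S"
    if "S \<in> ?S" "\<And>s. s \<in> ?D \<Longrightarrow> m \<le> det_objective T \<rho> C s" for S m
    using stoch_objective_ge[OF \<open>prob_space M\<close> int assms(13,7) nonneg expectation[OF order_refl] that]
    by simp
  show ?thesis
  proof (intro conjI allI impI antisym INF_greatest)
    fix s assume s: "is_arg_min (det_objective T \<rho> C) (\<lambda>S. S \<in> ?D) s"
    then have "det_objective T \<rho> C s \<le> stoch_objective M \<xi> T \<rho> C S" if "S \<in> ?S" for S
      using that by (intro lower) (auto simp: is_arg_min_linorder)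
    then show "is_arg_min (stoch_objective M \<xi> T \<rho> C) (\<lambda>S. S \<in> ?S) (\<lambda>t \<omega>. s t)"
      using s const_stoch_feasible[of s] by (auto simp: is_arg_min_linorder const)
  next
    fix s assume "s \<in> ?D"
    then show "(INF S\<in>?S. ereal (stoch_objective M \<xi> T \<rho> C S)) \<le> ereal (det_objective T \<rho> C s)"
      using const_stoch_feasible by (intro INF_lower2[of "\<lambda>t \<omega>. s t"]) (auto simp: const)
  next
    fix S assume S: "S \<in> ?S"
    show "(INF s\<in>?D. ereal (det_objective T \<rho> C s)) \<le> ereal (stoch_objective M \<xi> T \<rho> C S)"
    proof (rule ccontr)
      \<comment> \<open>A real number strictly between the two values is a lower bound of the
        deterministic costs; taking it instead of the infimum keeps the bound real-valued.\<close>
      assume "\<not> ?thesis"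
      then have "ereal (stoch_objective M \<xi> T \<rho> C S) < (INF s\<in>?D. ereal (det_objective T \<rho> C s))"
        by (simp only: not_le)
      from ereal_dense2[OF this] obtain m where m: "ereal (stoch_objective M \<xi> T \<rho> C S) < ereal m"
        "ereal m < (INF s\<in>?D. ereal (det_objective T \<rho> C s))"
        by blast
      have "m \<le> det_objective T \<rho> C s" if "s \<in> ?D" for s
        using m(2) less_INF_D[OF _ that] by fastforce
      then have "m \<le> stoch_objective M \<xi> T \<rho> C S"
        by (rule lower[OF S])
      with m(1) show False by simp
    qed
  qed
qed

end
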